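(* The system $\mathcal{C}_{\tilde M^\infty}=\{C_{\tilde M^\infty}(n) : n\in\mathbb{N}^*\}$ is not noetherian, i.e. there exists $m\in\mathbb{N}$, $m>1$, such that the ring $C_{\tilde M^\infty}(m)$ is not noetherian.
   Context: For $\epsilon>0$ let $I_\epsilon=[0,\epsilon]\subset\mathbb{R}$, and let $\mathcal{E}(I_\epsilon^n)$ be the ring of real-valued $C^\infty$ functions on $I_\epsilon^n$. For $\alpha\in\mathbb{N}^n$ write $|\alpha|=\alpha_1+\dots+\alpha_n$ and $D^\alpha=\partial^{|\alpha|}/\partial x_1^{\alpha_1}\cdots\partial x_n^{\alpha_n}$. Given a positive function $M(t)$ defined for all sufficiently large real $t$, a function $f\in\mathcal{E}(I_\epsilon^n)$ is in the class $M$ if there exist $C>0$, $\rho>0$ such that $|D^\alpha f(x)|\le C\rho^{|\alpha|}M(|\alpha|)$ for all $x\in I_\epsilon^n$ and all $\alpha\in\mathbb{N}^n$ with $|\alpha|$ sufficiently large; $C_M(I_\epsilon^n)$ denotes the set of such functions. Let $\tilde m(t)=t\log t+t\log\log\log t$ for $t>e^e$ and, for each integer $p\ge 1$, let $\tilde m_p(t)=\tilde m(pt)$ and $\tilde M_p(t)=e^{\tilde m_p(t)}$ (for $t$ large). Put $C_{\tilde M^\infty}(I_\epsilon^n)=\bigcup_{p\ge 1}C_{\tilde M_p}(I_\epsilon^n)$. For $n\ge1$, $C_{\tilde M^\infty}(n)$ denotes the ring of germs at the origin of functions belonging to $C_{\tilde M^\infty}(I_\epsilon^n)$ for some small $\epsilon>0$.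 A system $\{\mathcal{C}_n\}$ of rings is called noetherian if all the rings $\mathcal{C}_n$ are noetherian. *)

theory Defs
  imports "HOL-Analysis.Analysis" "HOL-Algebra.Ring_Divisibility" "HOL-Algebra.QuotRing"
begin

text \<open>
  The dimension is a natural number that gets quantified, so a point of \<open>\<real>\<^sup>n\<close> is an
  extensional function on \<open>{..<n}\<close> (coordinates are numbered from 0).  The topology on
  \<open>nat \<Rightarrow> real\<close> is the product topology, which on these sets is the Euclidean one.
  A function on the cube is a total function of which only the values on the cube matter.
\<close>

definition cube :: "nat \<Rightarrow> real \<Rightarrow> (nat \<Rightarrow> real) set" where
  "cube n \<epsilon> = {..<n} \<rightarrow>\<^sub>E {0..\<epsilon>}"

text \<open>The derivative is taken within \<open>{0..\<epsilon>}\<close>, hence one-sided on the faces of the cube.\<close>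

definition partial ::
  "real \<Rightarrow> nat \<Rightarrow> ((nat \<Rightarrow> real) \<Rightarrow> real) \<Rightarrow> (nat \<Rightarrow> real) \<Rightarrow> real" where
  "partial \<epsilon> i f x = vector_derivative (\<lambda>t. f (x(i := t))) (at (x i) within {0..\<epsilon>})"

definition partials ::
  "real \<Rightarrow> nat list \<Rightarrow> ((nat \<Rightarrow> real) \<Rightarrow> real) \<Rightarrow> (nat \<Rightarrow> real) \<Rightarrow> real" where
  "partials \<epsilon> is f = foldr (partial \<epsilon>) is f"

text \<open>
  \<open>C\<^sup>\<infinity>\<close> on the closed cube: all iterated partial derivatives, in any order, exist and are
  continuous on the whole cube.
\<close>

definition smooth_on_cube :: "nat \<Rightarrow> real \<Rightarrow> ((nat \<Rightarrow> real) \<Rightarrow> real) set" where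
  "smooth_on_cube n \<epsilon> = {f. \<forall>is. set is \<subseteq> {..<n} \<longrightarrow>
     continuous_on (cube n \<epsilon>) (partials \<epsilon> is f) \<and>
     (\<forall>i<n. \<forall>x\<in>cube n \<epsilon>.
        (\<lambda>t. partials \<epsilon> is f (x(i := t))) differentiable (at (x i) within {0..\<epsilon>}))}"

definition multi_order :: "nat \<Rightarrow> (nat \<Rightarrow> nat) \<Rightarrow> nat" where
  "multi_order n \<alpha> = (\<Sum>i<n. \<alpha> i)"

definition multi_deriv ::
  "nat \<Rightarrow> real \<Rightarrow> (nat \<Rightarrow> nat) \<Rightarrow> ((nat \<Rightarrow> real) \<Rightarrow> real) \<Rightarrow> (nat \<Rightarrow> real) \<Rightarrow> real" where
  "multi_deriv n \<epsilon> \<alpha> f = partials \<epsilon> (concat (map (\<lambda>i. replicate (\<alpha> i) i) [0..<n])) f"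

definition DC_class ::
  "(real \<Rightarrow> real) \<Rightarrow> nat \<Rightarrow> real \<Rightarrow> ((nat \<Rightarrow> real) \<Rightarrow> real) set" where
  "DC_class M n \<epsilon> = {f \<in> smooth_on_cube n \<epsilon>.
     \<exists>C>0. \<exists>\<rho>>0. \<exists>N. \<forall>\<alpha>. multi_order n \<alpha> \<ge> N \<longrightarrow>
       (\<forall>x\<in>cube n \<epsilon>. \<bar>multi_deriv n \<epsilon> \<alpha> f x\<bar> \<le>
          C * \<rho> ^ multi_order n \<alpha> * M (real (multi_order n \<alpha>)))}"

text \<open>
  The formula is meaningful for \<open>t > exp (exp 1)\<close> only; the smaller arguments are never used
  in an essential way, since \<^const>\<open>DC_class\<close> only looks at large orders.
\<close>

definition m_tilde :: "real \<Rightarrow> real" where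
  "m_tilde t = t * ln t + t * ln (ln (ln t))"

definition M_tilde :: "nat \<Rightarrow> real \<Rightarrow> real" where
  "M_tilde p t = exp (m_tilde (real p * t))"

definition DC_class_inf :: "nat \<Rightarrow> real \<Rightarrow> ((nat \<Rightarrow> real) \<Rightarrow> real) set" where
  "DC_class_inf n \<epsilon> = (\<Union>p\<in>{1..}. DC_class (M_tilde p) n \<epsilon>)"

text \<open>
  The germs at the origin: representatives under pointwise operations, modulo the ideal of
  representatives vanishing on some small cube at the origin.  A coset of this ideal is
  precisely a class of representatives that agree on some small cube at the origin.
\<close>

definition representatives :: "nat \<Rightarrow> ((nat \<Rightarrow> real) \<Rightarrow> real) ring" where
  "representatives n =
     \<lparr>carrier = (\<Union>\<epsilon>\<in>{0<..}. DC_class_inf n \<epsilon>),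
      mult = (\<lambda>f g x. f x * g x), one = (\<lambda>x. 1),
      zero = (\<lambda>x. 0), add = (\<lambda>f g x. f x + g x)\<rparr>"

definition null_germ :: "nat \<Rightarrow> ((nat \<Rightarrow> real) \<Rightarrow> real) set" where
  "null_germ n = {f \<in> carrier (representatives n). \<exists>\<delta>>0. \<forall>x\<in>cube n \<delta>. f x = 0}"

definition germ_ring :: "nat \<Rightarrow> ((nat \<Rightarrow> real) \<Rightarrow> real) set ring" where
  "germ_ring n = representatives n Quot null_germ n"

definition noetherian_system :: "(nat \<Rightarrow> ('a, 'b) ring_scheme) \<Rightarrow> bool" where
  "noetherian_system \<C> \<longleftrightarrow> (\<forall>n\<ge>1. noetherian_ring (\<C> n))"

end

theory Submission
  imports Defs
begin

text \<open>
  Up to constants, \<open>M_tilde p k\<close> lies between powers of \<open>k!\<close>, so the union over \<open>p\<close> is the union of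
  all Gevrey classes.  It contains the flat functions \<open>f\<^sub>j(x) = exp (- 1 / x\<^sub>0) / x\<^sub>0 ^ j\<close>, which satisfy
  \<open>f\<^sub>j = x\<^sub>0 f\<^bsub>j+1\<^esub>\<close>.  If the chain of principal ideals \<open>(f\<^sub>0) \<subseteq> (f\<^sub>1) \<subseteq> \<dots>\<close> became stationary, then
  \<open>f\<^bsub>j+1\<^esub> = h f\<^sub>j = h x\<^sub>0 f\<^bsub>j+1\<^esub>\<close> near the origin, hence \<open>h x\<^sub>0 = 1\<close> for small \<open>x\<^sub>0 > 0\<close>, although \<open>h\<close> is
  bounded.
\<close>

section \<open>Iterated partial derivatives on a cube\<close>

lemma cube_upd:
  assumes "x \<in> cube n \<epsilon>" "i < n" "t \<in> {0..\<epsilon>}"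
  shows "x(i := t) \<in> cube n \<epsilon>"
  unfolding cube_def
proof (rule PiE_I)
  show "(x(i := t)) j \<in> {0..\<epsilon>}" if "j \<in> {..<n}" for j
    using assms that PiE_mem[of x "{..<n}" "\<lambda>_. {0..\<epsilon>}" j] by (cases "j = i") (simp_all add: cube_def)
  show "(x(i := t)) j = undefined" if "j \<notin> {..<n}" for j
    using assms that PiE_arb[of x "{..<n}" "\<lambda>_. {0..\<epsilon>}" j] by (cases "j = i") (simp_all add: cube_def)
qed

lemma cube_coord: "x \<in> cube n \<epsilon> \<Longrightarrow> i < n \<Longrightarrow> x i \<in> {0..\<epsilon>}"
  using PiE_mem[of x "{..<n}" "\<lambda>_. {0..\<epsilon>}" i] by (simp add: cube_def)

lemma cube_mono: "\<delta> \<le> \<epsilon> \<Longrightarrow> cube n \<delta> \<subseteq> cube n \<epsilon>"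
  unfolding cube_def by (rule PiE_mono) auto

text \<open>Tychonoff: the cube is a product over all natural numbers whose factors beyond the
  dimension are the singleton \<open>{undefined}\<close>. Compactness later bounds each derivative
  separately.\<close>

lemma compact_cube: "compact (cube n \<epsilon>)"
proof -
  define S where "S = (\<lambda>i. if i < n then {0..\<epsilon>} else {undefined::real})"
  have "x \<in> cube n \<epsilon> \<longleftrightarrow> x \<in> PiE UNIV S" for x
    unfolding cube_def PiE_iff S_def extensional_def
    by (simp add: all_conj_distrib) (metis lessThan_iff singletonD singletonI)
  then have "cube n \<epsilon> = PiE UNIV S" by blast
  moreover have "compactin (product_topology (\<lambda>_. euclidean) UNIV) (PiE UNIV S)"
    by (subst compactin_PiE) (simp add: S_def compactin_euclidean_iff)
  ultimately show ?thesis
    by (metis euclidean_product_topology compactin_euclidean_iff)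
qed

text \<open>Since \<epsilon> is positive, the interval is non-degenerate, so derivatives within it
  are unique even at the endpoints.\<close>

lemma partial_eqI:
  assumes "0 < \<epsilon>" "x i \<in> {0..\<epsilon>}"
    and "((\<lambda>t. f (x(i := t))) has_real_derivative D) (at (x i) within {0..\<epsilon>})"
  shows "partial \<epsilon> i f x = D"
  unfolding partial_def
  by (intro vector_derivative_within_closed_interval assms(1,2))
     (use assms(3) in \<open>simp add: has_real_derivative_iff_has_vector_derivative\<close>)

lemma smooth_has_partial:
  assumes "f \<in> smooth_on_cube n \<epsilon>" "set L \<subseteq> {..<n}" "i < n" "x \<in> cube n \<epsilon>"
  shows "((\<lambda>t. partials \<epsilon> L f (x(i := t))) has_real_derivative partials \<epsilon> (i # L) f x)
           (at (x i) within {0..\<epsilon>})"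
proof -
  have "(\<lambda>t. partials \<epsilon> L f (x(i := t))) differentiable (at (x i) within {0..\<epsilon>})"
    using assms by (auto simp: smooth_on_cube_def)
  then show ?thesis
    by (simp add: has_real_derivative_iff_has_vector_derivative partials_def partial_def
        vector_derivative_works)
qed

lemma smooth_continuous:
  "f \<in> smooth_on_cube n \<epsilon> \<Longrightarrow> set L \<subseteq> {..<n} \<Longrightarrow> continuous_on (cube n \<epsilon>) (partials \<epsilon> L f)"
  by (auto simp: smooth_on_cube_def)

text \<open>Moving one coordinate within \<open>{0..\<epsilon>}\<close> never leaves the cube, so
  the derivative sees only values on the cube.\<close>

lemma has_derivative_cube_cong:
  assumes "x \<in> cube n \<epsilon>" "i < n" "\<And>y. y \<in> cube n \<epsilon> \<Longrightarrow> f y = g y"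
  shows "((\<lambda>t. f (x(i := t))) has_real_derivative D) (at (x i) within {0..\<epsilon>}) \<longleftrightarrow>
         ((\<lambda>t. g (x(i := t))) has_real_derivative D) (at (x i) within {0..\<epsilon>})"
  using assms cube_coord[OF assms(1,2)] cube_upd[OF assms(1,2)]
  by (intro has_field_derivative_cong_eventually)
     (auto simp: eventually_at_filter intro!: always_eventually)

text \<open>
  \<open>G\<close> is a guess for all iterated partial derivatives of \<open>f\<close>; checking one differentiation at a time
  gives smoothness and identifies \<^const>\<open>partials\<close> with the guess.
\<close>

locale iterated_partials =
  fixes n :: nat and \<epsilon> :: real and f :: "(nat \<Rightarrow> real) \<Rightarrow> real"
    and G :: "nat list \<Rightarrow> (nat \<Rightarrow> real) \<Rightarrow> real"
  assumes pos: "0 < \<epsilon>"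
    and base: "\<And>x. x \<in> cube n \<epsilon> \<Longrightarrow> G [] x = f x"
    and cont: "\<And>L. set L \<subseteq> {..<n} \<Longrightarrow> continuous_on (cube n \<epsilon>) (G L)"
    and step: "\<And>L i x. set L \<subseteq> {..<n} \<Longrightarrow> i < n \<Longrightarrow> x \<in> cube n \<epsilon> \<Longrightarrow>
      ((\<lambda>t. G L (x(i := t))) has_real_derivative G (i # L) x) (at (x i) within {0..\<epsilon>})"
begin

lemma partials_eq:
  assumes "set L \<subseteq> {..<n}" "x \<in> cube n \<epsilon>"
  shows "partials \<epsilon> L f x = G L x"
  using assms
proof (induction L arbitrary: x)
  case Nil
  then show ?case by (simp add: partials_def base)
next
  case (Cons i L)
  have "((\<lambda>t. partials \<epsilon> L f (x(i := t))) has_real_derivative G (i # L) x) (at (x i) within {0..\<epsilon>})"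
    using step[of L i x] Cons has_derivative_cube_cong[of x n \<epsilon> i "partials \<epsilon> L f" "G L"] by auto
  then have "partial \<epsilon> i (partials \<epsilon> L f) x = G (i # L) x"
    using Cons.prems cube_coord by (intro partial_eqI pos) auto
  then show ?case by (simp add: partials_def)
qed

lemma smooth: "f \<in> smooth_on_cube n \<epsilon>"
  unfolding smooth_on_cube_def
proof (intro CollectI allI impI conjI ballI)
  fix L assume L: "set L \<subseteq> {..<n}"
  show "continuous_on (cube n \<epsilon>) (partials \<epsilon> L f)"
    using cont[OF L] partials_eq[OF L] by (simp cong: continuous_on_cong)
  fix i x assume "i < n" "x \<in> cube n \<epsilon>"
  then have "((\<lambda>t. partials \<epsilon> L f (x(i := t))) has_real_derivative G (i # L) x) (at (x i) within {0..\<epsilon>})"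
    using step[of L i x] L has_derivative_cube_cong[of x n \<epsilon> i "partials \<epsilon> L f" "G L"]
      partials_eq[OF L] by auto
  then show "(\<lambda>t. partials \<epsilon> L f (x(i := t))) differentiable (at (x i) within {0..\<epsilon>})"
    using real_differentiable_def by blast
qed

end

text \<open>The operator \<open>partial \<delta>\<close> differentiates within a smaller interval
  than \<open>partial \<epsilon>\<close>, so the two are different terms. They agree because a
  derivative within a set is also one within a subset, and it is unique there.\<close>

lemma iterated_partials_restrict:
  assumes "f \<in> smooth_on_cube n \<epsilon>" "0 < \<delta>" "\<delta> \<le> \<epsilon>"
  shows "iterated_partials n \<delta> f (\<lambda>L. partials \<epsilon> L f)"
proof
  have sub: "cube n \<delta> \<subseteq> cube n \<epsilon>" using assms cube_mono by auto
  show "0 < \<delta>" by fact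
  show "partials \<epsilon> [] f x = f x" for x by (simp add: partials_def)
  show "continuous_on (cube n \<delta>) (partials \<epsilon> L f)" if "set L \<subseteq> {..<n}" for L
    using smooth_continuous[OF assms(1) that] sub continuous_on_subset by blast
  show "((\<lambda>t. partials \<epsilon> L f (x(i := t))) has_real_derivative partials \<epsilon> (i # L) f x)
           (at (x i) within {0..\<delta>})"
    if "set L \<subseteq> {..<n}" "i < n" "x \<in> cube n \<delta>" for L i x
    using smooth_has_partial[OF assms(1) that(1,2)] that(3) sub assms(3)
    by (meson DERIV_subset atLeastatMost_subset_iff order_refl subsetD)
qed

section \<open>Derivatives of sums, constants and products\<close>

lemma iterated_partials_add:
  assumes "0 < \<epsilon>" "f \<in> smooth_on_cube n \<epsilon>" "g \<in> smooth_on_cube n \<epsilon>"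
  shows "iterated_partials n \<epsilon> (\<lambda>x. f x + g x) (\<lambda>L x. partials \<epsilon> L f x + partials \<epsilon> L g x)"
proof
  show "0 < \<epsilon>" by fact
  show "partials \<epsilon> [] f x + partials \<epsilon> [] g x = f x + g x" for x
    by (simp add: partials_def)
  show "continuous_on (cube n \<epsilon>) (\<lambda>x. partials \<epsilon> L f x + partials \<epsilon> L g x)"
    if "set L \<subseteq> {..<n}" for L
    by (intro continuous_on_add smooth_continuous assms that)
  show "((\<lambda>t. partials \<epsilon> L f (x(i := t)) + partials \<epsilon> L g (x(i := t))) has_real_derivative
      partials \<epsilon> (i # L) f x + partials \<epsilon> (i # L) g x) (at (x i) within {0..\<epsilon>})"
    if "set L \<subseteq> {..<n}" "i < n" "x \<in> cube n \<epsilon>" for L i x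
    by (intro DERIV_add smooth_has_partial[OF _ that] assms)
qed

lemma iterated_partials_const:
  assumes "0 < \<epsilon>"
  shows "iterated_partials n \<epsilon> (\<lambda>x. c) (\<lambda>L x. if L = [] then c else 0)"
  using assms by unfold_locales auto

text \<open>
  The index pairs of the Leibniz rule.  Both components are sublists, hence sorted when the list is,
  so bounding a product never requires commuting partial derivatives.
\<close>

fun splits :: "'a list \<Rightarrow> ('a list \<times> 'a list) list" where
  "splits [] = [([], [])]"
| "splits (a # as) =
     map (\<lambda>(bs, cs). (a # bs, cs)) (splits as) @ map (\<lambda>(bs, cs). (bs, a # cs)) (splits as)"

lemma length_splits: "length (splits as) = 2 ^ length as"
  by (induction as) auto

lemma splits_subset: "(bs, cs) \<in> set (splits as) \<Longrightarrow> set bs \<subseteq> set as \<and> set cs \<subseteq> set as"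
proof (induction as arbitrary: bs cs)
  case (Cons a as)
  then consider bs' where "bs = a # bs'" "(bs', cs) \<in> set (splits as)"
    | cs' where "cs = a # cs'" "(bs, cs') \<in> set (splits as)"
    by auto
  then show ?case
    by cases (use Cons.IH in auto)
qed simp

lemma splits_length: "(bs, cs) \<in> set (splits as) \<Longrightarrow> length bs + length cs = length as"
  by (induction as arbitrary: bs cs) auto

lemma splits_sorted: "(bs, cs) \<in> set (splits as) \<Longrightarrow> sorted as \<Longrightarrow> sorted bs \<and> sorted cs"
  by (induction as arbitrary: bs cs) (use splits_subset in fastforce)+

lemma continuous_on_sum_list:
  fixes F :: "'i \<Rightarrow> 'a::topological_space \<Rightarrow> real"
  shows "(\<And>i. i \<in> set is \<Longrightarrow> continuous_on S (F i)) \<Longrightarrow> continuous_on S (\<lambda>x. \<Sum>i\<leftarrow>is. F i x)"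
  by (induction "is") (auto intro!: continuous_intros)

lemma DERIV_sum_list:
  fixes F :: "'i \<Rightarrow> real \<Rightarrow> real"
  shows "(\<And>i. i \<in> set is \<Longrightarrow> (F i has_real_derivative D i) (at x within S)) \<Longrightarrow>
    ((\<lambda>x. \<Sum>i\<leftarrow>is. F i x) has_real_derivative (\<Sum>i\<leftarrow>is. D i)) (at x within S)"
proof (induction "is")
  case (Cons i "is")
  then show ?case
    by (simp add: DERIV_add)
qed simp

text \<open>The two halves of \<open>splits (i # L)\<close> are the two terms of the product rule:
  the new derivative falls on \<open>f\<close> or on \<open>g\<close>.\<close>

lemma iterated_partials_mult:
  assumes "0 < \<epsilon>" "f \<in> smooth_on_cube n \<epsilon>" "g \<in> smooth_on_cube n \<epsilon>"
  shows "iterated_partials n \<epsilon> (\<lambda>x. f x * g x)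
    (\<lambda>L x. \<Sum>(A, B)\<leftarrow>splits L. partials \<epsilon> A f x * partials \<epsilon> B g x)"
proof
  show "0 < \<epsilon>" by fact
  show "(\<Sum>(A, B)\<leftarrow>splits []. partials \<epsilon> A f x * partials \<epsilon> B g x) = f x * g x" for x
    by (simp add: partials_def)
  show "continuous_on (cube n \<epsilon>) (\<lambda>x. \<Sum>(A, B)\<leftarrow>splits L. partials \<epsilon> A f x * partials \<epsilon> B g x)"
    if "set L \<subseteq> {..<n}" for L
    unfolding split_def
  proof (rule continuous_on_sum_list)
    fix p assume "p \<in> set (splits L)"
    then have "set (fst p) \<subseteq> {..<n}" "set (snd p) \<subseteq> {..<n}"
      using that splits_subset[of "fst p" "snd p" L] by auto
    then show "continuous_on (cube n \<epsilon>) (\<lambda>x. partials \<epsilon> (fst p) f x * partials \<epsilon> (snd p) g x)"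
      by (intro continuous_on_mult smooth_continuous assms)
  qed
  fix L i x assume L: "set L \<subseteq> {..<n}" and i: "i < n" and x: "x \<in> cube n \<epsilon>"
  have "((\<lambda>t. \<Sum>p\<leftarrow>splits L. partials \<epsilon> (fst p) f (x(i := t)) * partials \<epsilon> (snd p) g (x(i := t)))
     has_real_derivative
      (\<Sum>p\<leftarrow>splits L. partials \<epsilon> (i # fst p) f x * partials \<epsilon> (snd p) g x
         + partials \<epsilon> (i # snd p) g x * partials \<epsilon> (fst p) f x)) (at (x i) within {0..\<epsilon>})"
  proof (rule DERIV_sum_list)
    fix p assume "p \<in> set (splits L)"
    then have "set (fst p) \<subseteq> {..<n}" "set (snd p) \<subseteq> {..<n}"
      using L splits_subset[of "fst p" "snd p" L] by auto
    then show "((\<lambda>t. partials \<epsilon> (fst p) f (x(i := t)) * partials \<epsilon> (snd p) g (x(i := t)))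
      has_real_derivative partials \<epsilon> (i # fst p) f x * partials \<epsilon> (snd p) g x
         + partials \<epsilon> (i # snd p) g x * partials \<epsilon> (fst p) f x) (at (x i) within {0..\<epsilon>})"
      using DERIV_mult[OF smooth_has_partial[OF assms(2) _ i x] smooth_has_partial[OF assms(3) _ i x]]
      by fastforce
  qed
  then show "((\<lambda>t. \<Sum>(A, B)\<leftarrow>splits L. partials \<epsilon> A f (x(i := t)) * partials \<epsilon> B g (x(i := t)))
      has_real_derivative (\<Sum>(A, B)\<leftarrow>splits (i # L). partials \<epsilon> A f x * partials \<epsilon> B g x))
      (at (x i) within {0..\<epsilon>})"
    by (simp add: split_def sum_list_addf o_def mult.commute)
qed

section \<open>Gevrey bounds\<close>

text \<open>One term of the exponential series is at most the whole sum. This is the device by which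
  every geometric factor below is absorbed into one more factorial.\<close>

lemma power_le_exp_fact:
  fixes a :: real
  assumes "0 \<le> a"
  shows "a ^ k \<le> exp a * fact k"
proof -
  have "(\<Sum>i\<in>{k}. a ^ i /\<^sub>R fact i) \<le> (\<Sum>i. a ^ i /\<^sub>R fact i)"
    using assms by (intro sum_le_suminf summable_exp_generic) auto
  then show ?thesis
    by (simp add: exp_def divide_simps mult.commute)
qed

text \<open>The triple logarithm is at most the logarithm, so with \<open>t = p * k\<close> the
  weight is at most \<open>t ^ (2 * p * k)\<close>; then \<open>k ^ k\<close> is at most
  \<open>exp k * fact k\<close>.\<close>

lemma M_tilde_le:
  assumes "1 \<le> p"
  shows "\<exists>A\<ge>0. \<forall>k\<ge>4. M_tilde p (real k) \<le> A ^ k * fact k ^ (2 * p)"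
proof (intro exI conjI allI impI)
  define A where "A = (real p * exp 1) ^ (2 * p)"
  show "0 \<le> A" by (simp add: A_def)
  fix k :: nat assume k: "4 \<le> k"
  define t where "t = real p * real k"
  have t: "4 \<le> t" using assms k mult_mono[of 1 "real p" 4 "real k"] by (simp add: t_def)
  \<comment> \<open>Already \<open>t \<ge> 4 > exp 1\<close> makes \<open>ln t\<close> and
    \<open>ln (ln t)\<close> positive, so \<open>ln y \<le> y - 1\<close> applies to both.\<close>
  have "1 < ln t" using exp_le t ln_less_cancel_iff[of "exp 1" t] by simp
  then have "0 < ln (ln t)" by simp
  then have "ln (ln (ln t)) \<le> ln (ln t) - 1" by (rule ln_le_minus_one)
  also have "\<dots> \<le> ln t - 1 - 1" using ln_le_minus_one[of "ln t"] \<open>1 < ln t\<close> by simp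
  finally have "t * ln (ln (ln t)) \<le> t * ln t"
    using t by (intro mult_left_mono) auto
  then have "m_tilde t \<le> real (2 * p * k) * ln t"
    by (simp add: m_tilde_def t_def mult_ac)
  then have "M_tilde p (real k) \<le> exp (real (2 * p * k) * ln t)"
    by (simp add: M_tilde_def t_def)
  also have "\<dots> = t ^ (2 * p * k)"
    unfolding exp_of_nat_mult using t by simp
  also have "\<dots> = ((real p) ^ k * (real k) ^ k) ^ (2 * p)"
    by (simp only: t_def power_mult_distrib power_mult[symmetric] mult.commute mult.left_commute)
  also have "\<dots> \<le> ((real p) ^ k * (exp (real k) * fact k)) ^ (2 * p)"
    by (intro power_mono mult_left_mono power_le_exp_fact) auto
  also have "\<dots> = A ^ k * fact k ^ (2 * p)"
    using exp_of_nat_mult[of k "1::real"]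
    by (simp add: A_def power_mult_distrib power_mult[symmetric] mult.commute[of k])
  finally show "M_tilde p (real k) \<le> A ^ k * fact k ^ (2 * p)" .
qed

lemma fact_power_le_M_tilde:
  assumes "1 \<le> q" "27 \<le> k"
  shows "fact k ^ q \<le> M_tilde q (real k)"
proof -
  define t where "t = real q * real k"
  have kt: "real k \<le> t" using assms by (simp add: t_def)
  then have t: "27 \<le> t" using assms by simp
  have "1 \<le> ln (3::real)" using exp_le by (subst ln_ge_iff) auto
  then have "3 \<le> ln ((3::real) ^ 3)" by (subst ln_realpow) auto
  also have "\<dots> \<le> ln t" using t by (subst ln_le_cancel_iff) auto
  finally have "1 \<le> ln (ln t)" using exp_le by (subst ln_ge_iff) auto
  then have "0 \<le> ln (ln (ln t))" by simp
  have "fact k ^ q \<le> (real k ^ k) ^ q"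
    using fact_le_power[of k, where 'a = real] by (intro power_mono) auto
  also have "\<dots> \<le> (t ^ k) ^ q"
    using kt by (intro power_mono) auto
  also have "\<dots> = exp (t * ln t)"
    using t exp_of_nat_mult[of "k * q" "ln t"] by (simp add: power_mult[symmetric] t_def mult_ac)
  also have "\<dots> \<le> M_tilde q (real k)"
    using t \<open>0 \<le> ln (ln (ln t))\<close> by (simp add: M_tilde_def m_tilde_def flip: t_def)
  finally show ?thesis .
qed

section \<open>Multi-indices as sorted lists of coordinates\<close>

lemma index_list:
  fixes \<alpha> :: "nat \<Rightarrow> nat" and n :: nat
  defines "L \<equiv> concat (map (\<lambda>i. replicate (\<alpha> i) i) [0..<n])"
  shows "sorted L" "set L \<subseteq> {..<n}" "length L = multi_order n \<alpha>"
    "count (mset L) i = (if i < n then \<alpha> i else 0)"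
  unfolding L_def
proof (induction n)
  case (Suc n)
  {
    case 1
    show ?case using Suc(1,2) by (auto simp: sorted_append)
  next
    case 2
    show ?case using Suc(2) by auto
  next
    case 3
    show ?case using Suc(3) by (simp add: multi_order_def)
  next
    case 4
    show ?case using Suc(4) by simp
  }
qed (simp_all add: multi_order_def)

text \<open>A sorted list is determined by its multiset. Hence the sorted lists are exactly those
  along which \<open>multi_deriv\<close> differentiates, and bounds over multi-indices become bounds
  over sorted lists.\<close>

lemma sorted_is_index_list:
  fixes L :: "nat list"
  assumes "sorted L" "set L \<subseteq> {..<n}"
  shows "L = concat (map (\<lambda>i. replicate (count (mset L) i) i) [0..<n])" (is "_ = ?R")
proof -
  have "mset ?R = mset L"
  proof (rule multiset_eqI)
    fix i
    show "count (mset ?R) i = count (mset L) i"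
      using assms(2) by (subst index_list(4)) (auto simp: count_eq_zero_iff)
  qed
  then show ?thesis
    using properties_for_sort[of ?R L] index_list(1)[where n = n] assms(1) sorted_sort_id by metis
qed

text \<open>Unlike \<open>DC_class\<close>, the bound covers all orders and has no geometric factor:
  low orders go into \<open>C\<close>, and a geometric factor into a larger \<open>q\<close>. This
  makes closure under the ring operations easy to check.\<close>

definition gevrey_on_cube :: "nat \<Rightarrow> real \<Rightarrow> ((nat \<Rightarrow> real) \<Rightarrow> real) set" where
  "gevrey_on_cube n \<epsilon> = {f \<in> smooth_on_cube n \<epsilon>.
     \<exists>C>0. \<exists>q. \<forall>L. sorted L \<longrightarrow> set L \<subseteq> {..<n} \<longrightarrow>
       (\<forall>x\<in>cube n \<epsilon>. \<bar>partials \<epsilon> L f x\<bar> \<le> C * fact (length L) ^ q)}"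

lemma gevreyE:
  assumes "f \<in> gevrey_on_cube n \<epsilon>"
  obtains C q where "f \<in> smooth_on_cube n \<epsilon>" "C > 0"
    "\<And>L x. sorted L \<Longrightarrow> set L \<subseteq> {..<n} \<Longrightarrow> x \<in> cube n \<epsilon> \<Longrightarrow>
       \<bar>partials \<epsilon> L f x\<bar> \<le> C * fact (length L) ^ q"
  using assms unfolding gevrey_on_cube_def by blast

lemma gevrey_subset_DC_class_inf: "gevrey_on_cube n \<epsilon> \<subseteq> DC_class_inf n \<epsilon>"
proof
  fix f assume "f \<in> gevrey_on_cube n \<epsilon>"
  then obtain C q where f: "f \<in> smooth_on_cube n \<epsilon>" and C: "C > 0"
    and bound: "\<And>L x. sorted L \<Longrightarrow> set L \<subseteq> {..<n} \<Longrightarrow> x \<in> cube n \<epsilon> \<Longrightarrow>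
       \<bar>partials \<epsilon> L f x\<bar> \<le> C * fact (length L) ^ q"
    by (rule gevreyE) blast
  \<comment> \<open>The weight index is \<open>Suc q\<close> because the union over \<open>p\<close>
    starts at 1, while \<open>q\<close> may be 0.\<close>
  have "\<bar>multi_deriv n \<epsilon> \<alpha> f x\<bar> \<le>
      C * 1 ^ multi_order n \<alpha> * M_tilde (Suc q) (real (multi_order n \<alpha>))"
    if "27 \<le> multi_order n \<alpha>" "x \<in> cube n \<epsilon>" for \<alpha> x
  proof -
    let ?k = "multi_order n \<alpha>"
    have "\<bar>multi_deriv n \<epsilon> \<alpha> f x\<bar> \<le> C * fact ?k ^ q"
      using bound[OF index_list(1,2) that(2), of \<alpha>] by (simp add: multi_deriv_def index_list(3))
    also have "\<dots> \<le> C * fact ?k ^ Suc q"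
      using C fact_ge_1[of ?k, where 'a = real] by (intro mult_left_mono power_increasing) auto
    also have "\<dots> \<le> C * M_tilde (Suc q) (real ?k)"
      using C fact_power_le_M_tilde[of "Suc q" ?k] that(1) by (intro mult_left_mono) auto
    finally show ?thesis by simp
  qed
  then have "\<exists>C>0. \<exists>\<rho>>0. \<exists>N. \<forall>\<alpha>. multi_order n \<alpha> \<ge> N \<longrightarrow> (\<forall>x\<in>cube n \<epsilon>.
      \<bar>multi_deriv n \<epsilon> \<alpha> f x\<bar> \<le> C * \<rho> ^ multi_order n \<alpha> * M_tilde (Suc q) (real (multi_order n \<alpha>)))"
    using C zero_less_one by blast
  then have "f \<in> DC_class (M_tilde (Suc q)) n \<epsilon>"
    using f by (simp add: DC_class_def)
  then show "f \<in> DC_class_inf n \<epsilon>"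
    unfolding DC_class_inf_def by (intro UN_I[of "Suc q"]) auto
qed

lemma smooth_partial_bounded:
  assumes "f \<in> smooth_on_cube n \<epsilon>" "set L \<subseteq> {..<n}"
  shows "\<exists>B\<ge>0. \<forall>x\<in>cube n \<epsilon>. \<bar>partials \<epsilon> L f x\<bar> \<le> B"
proof -
  have "bounded (partials \<epsilon> L f ` cube n \<epsilon>)"
    using compact_cube compact_continuous_image compact_imp_bounded smooth_continuous[OF assms] by blast
  then obtain B where "\<forall>x\<in>cube n \<epsilon>. \<bar>partials \<epsilon> L f x\<bar> \<le> B"
    unfolding bounded_iff by auto
  then have "\<forall>x\<in>cube n \<epsilon>. \<bar>partials \<epsilon> L f x\<bar> \<le> max 0 B"
    by (simp add: le_max_iff_disj)
  then show ?thesis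
    by (meson max.cobounded1)
qed

text \<open>Low orders give finitely many derivatives, each bounded on the compact cube. At high
  orders the weight is compared with a factorial power, and the remaining factor
  \<open>(\<rho> * A) ^ k\<close> costs one further factorial.\<close>

lemma DC_class_inf_subset_gevrey: "DC_class_inf n \<epsilon> \<subseteq> gevrey_on_cube n \<epsilon>"
proof
  fix f assume "f \<in> DC_class_inf n \<epsilon>"
  then obtain p where p: "1 \<le> p" and "f \<in> DC_class (M_tilde p) n \<epsilon>"
    by (auto simp: DC_class_inf_def)
  then obtain C \<rho> N where f: "f \<in> smooth_on_cube n \<epsilon>" and C: "C > 0" and \<rho>: "\<rho> > 0"
    and high: "\<And>\<alpha> x. N \<le> multi_order n \<alpha> \<Longrightarrow> x \<in> cube n \<epsilon> \<Longrightarrow>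
      \<bar>multi_deriv n \<epsilon> \<alpha> f x\<bar> \<le> C * \<rho> ^ multi_order n \<alpha> * M_tilde p (real (multi_order n \<alpha>))"
    unfolding DC_class_def by blast
  obtain A where A: "0 \<le> A" and M: "\<And>k. 4 \<le> k \<Longrightarrow> M_tilde p (real k) \<le> A ^ k * fact k ^ (2 * p)"
    using M_tilde_le[OF p] by blast
  \<comment> \<open>The lists in \<open>S\<close> are those not known to exceed both thresholds:
    \<open>N\<close> from the class, 4 from the estimate of the weight.\<close>
  define S where "S = {L. set L \<subseteq> {..<n} \<and> length L \<le> max N 4}"
  have "finite S" unfolding S_def by (rule finite_lists_length_le) simp
  have "\<forall>L\<in>S. \<exists>B\<ge>0. \<forall>x\<in>cube n \<epsilon>. \<bar>partials \<epsilon> L f x\<bar> \<le> B"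
    using smooth_partial_bounded[OF f] by (auto simp: S_def)
  then obtain B where B: "\<And>L. L \<in> S \<Longrightarrow> 0 \<le> B L"
      "\<And>L x. L \<in> S \<Longrightarrow> x \<in> cube n \<epsilon> \<Longrightarrow> \<bar>partials \<epsilon> L f x\<bar> \<le> B L"
    by metis
  \<comment> \<open>The first summand serves the high orders, the second dominates each of the
    finitely many low-order bounds.\<close>
  define C' where "C' = C * exp (\<rho> * A) + sum B S"
  have "0 \<le> sum B S" using B(1) by (rule sum_nonneg)
  have "\<bar>partials \<epsilon> L f x\<bar> \<le> C' * fact (length L) ^ Suc (2 * p)"
    if L: "sorted L" "set L \<subseteq> {..<n}" and x: "x \<in> cube n \<epsilon>" for L x
  proof -
    let ?k = "length L"
    have F: "(1::real) \<le> fact ?k ^ Suc (2 * p)"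
      by (rule one_le_power) (rule fact_ge_1)
    show ?thesis
    proof (cases "L \<in> S")
      case True
      have "\<bar>partials \<epsilon> L f x\<bar> \<le> B L" using B(2) True x .
      also have "\<dots> \<le> sum B S" using True B(1) \<open>finite S\<close> by (intro member_le_sum) auto
      also have "\<dots> \<le> C' * 1" using C by (simp add: C'_def)
      also have "\<dots> \<le> C' * fact ?k ^ Suc (2 * p)"
        using F C \<open>0 \<le> sum B S\<close> by (intro mult_left_mono) (auto simp: C'_def)
      finally show ?thesis .
    next
      case False
      then have k: "N \<le> ?k" "4 \<le> ?k" using L by (auto simp: S_def)
      define \<alpha> where "\<alpha> = count (mset L)"
      have eq: "L = concat (map (\<lambda>i. replicate (\<alpha> i) i) [0..<n])"
        unfolding \<alpha>_def by (rule sorted_is_index_list) fact+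
      then have ord: "multi_order n \<alpha> = ?k" using index_list(3)[of \<alpha> n] by simp
      have "partials \<epsilon> L f x = multi_deriv n \<epsilon> \<alpha> f x"
        unfolding multi_deriv_def eq[symmetric] ..
      then have "\<bar>partials \<epsilon> L f x\<bar> \<le> C * \<rho> ^ ?k * M_tilde p (real ?k)"
        using high[of \<alpha> x] k x ord by simp
      also have "\<dots> \<le> C * \<rho> ^ ?k * (A ^ ?k * fact ?k ^ (2 * p))"
        using C \<rho> M[OF k(2)] by (intro mult_left_mono) auto
      also have "\<dots> = C * (\<rho> * A) ^ ?k * fact ?k ^ (2 * p)"
        by (simp add: power_mult_distrib)
      also have "\<dots> \<le> C * (exp (\<rho> * A) * fact ?k) * fact ?k ^ (2 * p)"
        using C \<rho> A by (intro mult_left_mono mult_right_mono power_le_exp_fact) auto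
      also have "\<dots> = C * exp (\<rho> * A) * fact ?k ^ Suc (2 * p)" by simp
      also have "\<dots> \<le> C' * fact ?k ^ Suc (2 * p)"
        using \<open>0 \<le> sum B S\<close> by (intro mult_right_mono) (auto simp: C'_def)
      finally show ?thesis .
    qed
  qed
  moreover have "C' > 0" using C \<open>0 \<le> sum B S\<close> by (simp add: C'_def add_pos_nonneg)
  ultimately show "f \<in> gevrey_on_cube n \<epsilon>"
    using f unfolding gevrey_on_cube_def by blast
qed

lemma DC_class_inf_eq_gevrey: "DC_class_inf n \<epsilon> = gevrey_on_cube n \<epsilon>"
  using gevrey_subset_DC_class_inf DC_class_inf_subset_gevrey by (rule equalityI[rotated])

lemma (in iterated_partials) gevreyI:
  assumes "C > 0" "\<And>L x. sorted L \<Longrightarrow> set L \<subseteq> {..<n} \<Longrightarrow> x \<in> cube n \<epsilon> \<Longrightarrow>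
    \<bar>G L x\<bar> \<le> C * fact (length L) ^ q"
  shows "f \<in> gevrey_on_cube n \<epsilon>"
proof -
  have "\<bar>partials \<epsilon> L f x\<bar> \<le> C * fact (length L) ^ q"
    if "sorted L" "set L \<subseteq> {..<n}" "x \<in> cube n \<epsilon>" for L x
    using assms(2) partials_eq that by simp
  with smooth assms(1) show ?thesis
    unfolding gevrey_on_cube_def by blast
qed

section \<open>Closure of Gevrey classes under restriction and ring operations\<close>

lemma gevrey_restrict:
  assumes "f \<in> gevrey_on_cube n \<epsilon>" "0 < \<delta>" "\<delta> \<le> \<epsilon>"
  shows "f \<in> gevrey_on_cube n \<delta>"
proof -
  obtain C q where "f \<in> smooth_on_cube n \<epsilon>" "C > 0"
    "\<And>L x. sorted L \<Longrightarrow> set L \<subseteq> {..<n} \<Longrightarrow> x \<in> cube n \<epsilon> \<Longrightarrow>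
       \<bar>partials \<epsilon> L f x\<bar> \<le> C * fact (length L) ^ q"
    using assms(1) by (rule gevreyE) blast
  then show ?thesis
    using assms(2,3) cube_mono[OF assms(3), of n]
    by (intro iterated_partials.gevreyI[OF iterated_partials_restrict, of f n \<epsilon> \<delta> C q]) auto
qed

lemma gevrey_const: "0 < \<epsilon> \<Longrightarrow> (\<lambda>x. c) \<in> gevrey_on_cube n \<epsilon>"
  by (rule iterated_partials.gevreyI[OF iterated_partials_const, of \<epsilon> "\<bar>c\<bar> + 1" n c 0]) auto

lemma gevrey_add:
  assumes "0 < \<epsilon>" "f \<in> gevrey_on_cube n \<epsilon>" "g \<in> gevrey_on_cube n \<epsilon>"
  shows "(\<lambda>x. f x + g x) \<in> gevrey_on_cube n \<epsilon>"
proof -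
  obtain C q where f: "f \<in> smooth_on_cube n \<epsilon>" "C > 0"
    "\<And>L x. sorted L \<Longrightarrow> set L \<subseteq> {..<n} \<Longrightarrow> x \<in> cube n \<epsilon> \<Longrightarrow>
       \<bar>partials \<epsilon> L f x\<bar> \<le> C * fact (length L) ^ q"
    using assms(2) by (rule gevreyE) blast
  obtain D r where g: "g \<in> smooth_on_cube n \<epsilon>" "D > 0"
    "\<And>L x. sorted L \<Longrightarrow> set L \<subseteq> {..<n} \<Longrightarrow> x \<in> cube n \<epsilon> \<Longrightarrow>
       \<bar>partials \<epsilon> L g x\<bar> \<le> D * fact (length L) ^ r"
    using assms(3) by (rule gevreyE) blast
  show ?thesis
  proof (rule iterated_partials.gevreyI[OF iterated_partials_add])
    fix L x assume L: "sorted L" "set L \<subseteq> {..<n}" "x \<in> cube n \<epsilon>"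
    let ?F = "fact (length L) :: real"
    have "\<bar>partials \<epsilon> L f x + partials \<epsilon> L g x\<bar> \<le> C * ?F ^ q + D * ?F ^ r"
      using f(3)[OF L] g(3)[OF L] by linarith
    \<comment> \<open>Factorials are at least 1, so both exponents may be raised to a common
      one.\<close>
    also have "\<dots> \<le> C * ?F ^ (q + r) + D * ?F ^ (q + r)"
      using f(2) g(2) by (intro add_mono mult_left_mono power_increasing fact_ge_1) auto
    finally show "\<bar>partials \<epsilon> L f x + partials \<epsilon> L g x\<bar> \<le> (C + D) * ?F ^ (q + r)"
      by (simp add: algebra_simps)
  qed (use assms(1) f g in auto)
qed

text \<open>The Leibniz sum has \<open>2 ^ k\<close> terms for a list of length \<open>k\<close>,
  each at most \<open>C * D * fact k ^ (q + r)\<close>. The number of terms is at most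
  \<open>exp 2 * fact k\<close>, which accounts for the exponent \<open>Suc (q + r)\<close>.\<close>

lemma gevrey_mult:
  assumes "0 < \<epsilon>" "f \<in> gevrey_on_cube n \<epsilon>" "g \<in> gevrey_on_cube n \<epsilon>"
  shows "(\<lambda>x. f x * g x) \<in> gevrey_on_cube n \<epsilon>"
proof -
  obtain C q where f: "f \<in> smooth_on_cube n \<epsilon>" "C > 0"
    "\<And>L x. sorted L \<Longrightarrow> set L \<subseteq> {..<n} \<Longrightarrow> x \<in> cube n \<epsilon> \<Longrightarrow>
       \<bar>partials \<epsilon> L f x\<bar> \<le> C * fact (length L) ^ q"
    using assms(2) by (rule gevreyE) blast
  obtain D r where g: "g \<in> smooth_on_cube n \<epsilon>" "D > 0"
    "\<And>L x. sorted L \<Longrightarrow> set L \<subseteq> {..<n} \<Longrightarrow> x \<in> cube n \<epsilon> \<Longrightarrow>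
       \<bar>partials \<epsilon> L g x\<bar> \<le> D * fact (length L) ^ r"
    using assms(3) by (rule gevreyE) blast
  show ?thesis
  proof (rule iterated_partials.gevreyI[OF iterated_partials_mult])
    fix L x assume L: "sorted L" "set L \<subseteq> {..<n}" and x: "x \<in> cube n \<epsilon>"
    let ?F = "fact (length L) :: real"
    define s where "s = map (\<lambda>(A, B). partials \<epsilon> A f x * partials \<epsilon> B g x) (splits L)"
    have "\<bar>t\<bar> \<le> (C * D) * ?F ^ (q + r)" if t: "t \<in> set s" for t
    proof -
      obtain A B where AB: "(A, B) \<in> set (splits L)"
        and t: "t = partials \<epsilon> A f x * partials \<epsilon> B g x"
        using t unfolding s_def by auto
      have le: "length A \<le> length L" "length B \<le> length L"
        using splits_length[OF AB] by auto
      have "\<bar>partials \<epsilon> A f x\<bar> \<le> C * fact (length A) ^ q"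
        using f(3)[of A x] splits_sorted[OF AB] splits_subset[OF AB] L x by auto
      also have "\<dots> \<le> C * ?F ^ q"
        using f(2) le by (intro mult_left_mono power_mono fact_mono) auto
      finally have 1: "\<bar>partials \<epsilon> A f x\<bar> \<le> C * ?F ^ q" .
      have "\<bar>partials \<epsilon> B g x\<bar> \<le> D * fact (length B) ^ r"
        using g(3)[of B x] splits_sorted[OF AB] splits_subset[OF AB] L x by auto
      also have "\<dots> \<le> D * ?F ^ r"
        using g(2) le by (intro mult_left_mono power_mono fact_mono) auto
      finally have "\<bar>partials \<epsilon> B g x\<bar> \<le> D * ?F ^ r" .
      with 1 have "\<bar>t\<bar> \<le> (C * ?F ^ q) * (D * ?F ^ r)"
        unfolding t abs_mult using f(2) by (intro mult_mono) auto
      then show ?thesis by (simp add: power_add mult_ac)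
    qed
    then have "\<bar>sum_list s\<bar> \<le> real (length s) * ((C * D) * ?F ^ (q + r))"
      by (induction s) (auto simp: algebra_simps intro!: order_trans[OF abs_triangle_ineq] add_mono)
    also have "length s = 2 ^ length L" by (simp add: s_def length_splits)
    also have "real (2 ^ length L) * ((C * D) * ?F ^ (q + r))
        \<le> (exp 2 * ?F) * ((C * D) * ?F ^ (q + r))"
      using f(2) g(2) power_le_exp_fact[of 2 "length L"] by (intro mult_right_mono) auto
    also have "\<dots> = (exp 2 * C * D) * ?F ^ Suc (q + r)" by simp
    finally show "\<bar>\<Sum>(A, B)\<leftarrow>splits L. partials \<epsilon> A f x * partials \<epsilon> B g x\<bar>
        \<le> (exp 2 * C * D) * ?F ^ Suc (q + r)"
      by (simp add: s_def)
  qed (use assms(1) f g in auto)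
qed

section \<open>The ring of germs\<close>

lemma carrier_representatives:
  "f \<in> carrier (representatives n) \<longleftrightarrow> (\<exists>\<epsilon>>0. f \<in> gevrey_on_cube n \<epsilon>)"
  by (auto simp: representatives_def DC_class_inf_eq_gevrey)

lemma representatives_simps:
  "mult (representatives n) f g = (\<lambda>x. f x * g x)"
  "add (representatives n) f g = (\<lambda>x. f x + g x)"
  "one (representatives n) = (\<lambda>x. 1)"
  "zero (representatives n) = (\<lambda>x. 0)"
  by (simp_all add: representatives_def)

lemma representatives_common_cube:
  assumes "f \<in> carrier (representatives n)" "g \<in> carrier (representatives n)"
  obtains \<epsilon> where "\<epsilon> > 0" "f \<in> gevrey_on_cube n \<epsilon>" "g \<in> gevrey_on_cube n \<epsilon>"
proof -
  obtain \<delta> \<gamma> where "\<delta> > 0" "f \<in> gevrey_on_cube n \<delta>" "\<gamma> > 0" "g \<in> gevrey_on_cube n \<gamma>"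
    using assms by (auto simp: carrier_representatives)
  then show thesis
    by (intro that[of "min \<delta> \<gamma>"]) (auto intro: gevrey_restrict)
qed

lemma const_in_representatives: "(\<lambda>x. c) \<in> carrier (representatives n)"
  unfolding carrier_representatives using gevrey_const zero_less_one by blast

lemma add_in_representatives:
  assumes "f \<in> carrier (representatives n)" "g \<in> carrier (representatives n)"
  shows "(\<lambda>x. f x + g x) \<in> carrier (representatives n)"
  by (rule representatives_common_cube[OF assms]) (use gevrey_add carrier_representatives in blast)

lemma mult_in_representatives:
  assumes "f \<in> carrier (representatives n)" "g \<in> carrier (representatives n)"
  shows "(\<lambda>x. f x * g x) \<in> carrier (representatives n)"
  by (rule representatives_common_cube[OF assms]) (use gevrey_mult carrier_representatives in blast)

lemma cring_representatives: "cring (representatives n)"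
proof (rule cringI)
  show "abelian_group (representatives n)"
  proof (rule abelian_groupI)
    fix f assume "f \<in> carrier (representatives n)"
    then show "\<exists>g\<in>carrier (representatives n). g \<oplus>\<^bsub>representatives n\<^esub> f = \<zero>\<^bsub>representatives n\<^esub>"
      using mult_in_representatives[OF const_in_representatives[of "-1"]]
      by (intro bexI[of _ "\<lambda>x. -1 * f x"]) (simp_all add: representatives_simps)
  qed (simp_all add: representatives_simps add_in_representatives const_in_representatives algebra_simps)
  show "comm_monoid (representatives n)"
    by (rule comm_monoidI)
      (simp_all add: representatives_simps mult_in_representatives const_in_representatives mult_ac)
qed (simp add: representatives_simps algebra_simps)

lemma mult_in_null_germ:
  assumes "f \<in> null_germ n" "g \<in> carrier (representatives n)"
  shows "(\<lambda>x. g x * f x) \<in> null_germ n"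
proof -
  obtain \<delta> where "f \<in> carrier (representatives n)" "\<delta> > 0" "\<forall>x\<in>cube n \<delta>. f x = 0"
    using assms(1) by (auto simp: null_germ_def)
  moreover from this have "\<forall>x\<in>cube n \<delta>. g x * f x = 0" by simp
  ultimately show ?thesis
    using mult_in_representatives[OF assms(2)] unfolding null_germ_def by blast
qed

lemma ideal_null_germ: "ideal (null_germ n) (representatives n)"
proof -
  interpret cring "representatives n" by (rule cring_representatives)
  show ?thesis
  proof (rule idealI)
    show "subgroup (null_germ n) (add_monoid (representatives n))"
    proof (rule subgroup.intro; (simp only: partial_object.simps monoid.simps)?)
      show "null_germ n \<subseteq> carrier (representatives n)"
        by (auto simp: null_germ_def)
    next
      show "\<zero>\<^bsub>representatives n\<^esub> \<in> null_germ n"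
        using const_in_representatives[of 0 n] zero_less_one
        unfolding null_germ_def representatives_simps by blast
    next
      fix f g assume f: "f \<in> null_germ n" and g: "g \<in> null_germ n"
      show "f \<oplus>\<^bsub>representatives n\<^esub> g \<in> null_germ n"
      proof -
        obtain \<delta> \<gamma> where "\<delta> > 0" "\<gamma> > 0" "\<forall>x\<in>cube n \<delta>. f x = 0" "\<forall>x\<in>cube n \<gamma>. g x = 0"
          using f g by (auto simp: null_germ_def)
        then have "min \<delta> \<gamma> > 0" "\<forall>x\<in>cube n (min \<delta> \<gamma>). f x + g x = 0"
          using subsetD[OF cube_mono[of "min \<delta> \<gamma>" \<delta> n]]
            subsetD[OF cube_mono[of "min \<delta> \<gamma>" \<gamma> n]] by simp_all
        then show ?thesis
          using f g add_in_representatives[of f n g]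
          unfolding null_germ_def representatives_simps by blast
      qed
    next
      fix f assume f: "f \<in> null_germ n"
      then have "f \<in> carrier (representatives n)" using f by (simp add: null_germ_def)
      then have "\<ominus>\<^bsub>representatives n\<^esub> f = (\<lambda>x. -1 * f x)"
        using mult_in_representatives[OF const_in_representatives[of "-1" n], of f]
        by (intro minus_equality) (simp_all add: representatives_simps)
      then have neg: "\<ominus>\<^bsub>representatives n\<^esub> f \<in> null_germ n"
        using mult_in_null_germ[OF f const_in_representatives[of "-1"]] by simp
      show "inv\<^bsub>add_monoid (representatives n)\<^esub> f \<in> null_germ n"
        using neg by (simp only: a_inv_def)
    qed
    fix f g assume f: "f \<in> null_germ n" and g: "g \<in> carrier (representatives n)"
    show "g \<otimes>\<^bsub>representatives n\<^esub> f \<in> null_germ n"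
      using mult_in_null_germ[OF f g] by (simp add: representatives_simps)
    then show "f \<otimes>\<^bsub>representatives n\<^esub> g \<in> null_germ n"
      by (simp add: representatives_simps mult.commute)
  qed (rule ring_axioms)
qed

lemma cring_germ_ring: "cring (germ_ring n)"
  unfolding germ_ring_def
  by (rule ideal.quotient_is_cring[OF ideal_null_germ cring_representatives])

section \<open>Ascending chains of principal ideals\<close>

lemma noetherian_divisor_chain:
  fixes R (structure)
  assumes "cring R" "noetherian_ring R"
    and a: "\<And>j::nat. a j \<in> carrier R"
    and dvd: "\<And>j. \<exists>x\<in>carrier R. a j = x \<otimes>\<^bsub>R\<^esub> a (Suc j)"
  shows "\<exists>j. \<exists>h\<in>carrier R. a (Suc j) = h \<otimes>\<^bsub>R\<^esub> a j"
proof -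
  interpret cring R by fact
  interpret noetherian_ring R by fact
  define C where "C = range (\<lambda>j. PIdl a j)"
  have mono: "PIdl a i \<subseteq> PIdl a j" if "i \<le> j" for i j
  proof (rule lift_Suc_mono_le[OF _ that, where f = "\<lambda>j. PIdl a j"])
    fix j
    obtain x where x: "x \<in> carrier R" "a j = x \<otimes> a (Suc j)" using dvd by blast
    then have "a j \<in> PIdl a (Suc j)" unfolding cgenideal_def by blast
    then show "PIdl a j \<subseteq> PIdl a (Suc j)"
      by (intro cgenideal_minimal cgenideal_ideal a)
  qed
  have "subset.chain {I. ideal I R} C"
    unfolding subset_chain_def C_def
  proof (intro conjI ballI)
    fix X Y assume "X \<in> range (\<lambda>j. PIdl a j)" "Y \<in> range (\<lambda>j. PIdl a j)"
    then obtain i j where "X = PIdl a i" "Y = PIdl a j" by blast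
    then show "X \<subseteq> Y \<or> Y \<subseteq> X" using mono[of i j] mono[of j i] by (cases "i \<le> j") simp_all
  next
    show "range (\<lambda>j. PIdl a j) \<subseteq> {I. ideal I R}"
      using cgenideal_ideal[OF a] by blast
  qed
  \<comment> \<open>In a noetherian ring a nonempty chain of ideals contains its union. So some
    \<open>PIdl a j\<close> contains all later generators, in particular
    \<open>a (Suc j)\<close>.\<close>
  then have "\<Union>C \<in> C" by (intro ideal_chain_is_trivial) (auto simp: C_def)
  then obtain j where "\<Union>C = PIdl a j" by (auto simp: C_def)
  moreover have "a (Suc j) \<in> \<Union>C" using cgenideal_self[OF a] by (auto simp: C_def)
  ultimately show ?thesis unfolding cgenideal_def by blast
qed

section \<open>Flat functions\<close>

text \<open>
  \<open>flat_deriv k j\<close> is the \<open>k\<close>-th derivative of \<open>exp (- 1 / t) / t ^ j\<close>; the recursion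
  differentiates this function once and then \<open>k\<close> times.
\<close>

primrec flat_deriv :: "nat \<Rightarrow> nat \<Rightarrow> real \<Rightarrow> real" where
  "flat_deriv 0 j t = (if t = 0 then 0 else exp (- (1 / t)) / t ^ j)"
| "flat_deriv (Suc k) j t = flat_deriv k (j + 2) t - real j * flat_deriv k (Suc j) t"

text \<open>This divisibility drives the ideal chain. It holds at \<open>t = 0\<close> too, where
  both sides vanish.\<close>

lemma flat_deriv_0_eq_mult: "flat_deriv 0 j t = t * flat_deriv 0 (Suc j) t"
  by simp

text \<open>With \<open>u = 1 / t\<close> this is the decay of \<open>u ^ j / exp u\<close> at
  infinity.\<close>

lemma flat_tendsto_0: "(flat_deriv 0 j \<longlongrightarrow> 0) (at_right 0)"
proof -
  have "((\<lambda>t::real. inverse t ^ j / exp (inverse t)) \<longlongrightarrow> 0) (at_right 0)"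
    by (rule filterlim_compose[OF tendsto_power_div_exp_0 filterlim_inverse_at_top_right])
  moreover have "\<forall>\<^sub>F t in at_right 0. inverse t ^ j / exp (inverse t) = flat_deriv 0 j t"
    using eventually_at_right_less[of "0::real"]
    by eventually_elim (simp add: exp_minus field_simps)
  ultimately show ?thesis by (rule Lim_transform_eventually)
qed

lemma flat_deriv_DERIV:
  assumes "0 \<le> t"
  shows "(flat_deriv k j has_real_derivative flat_deriv (Suc k) j t) (at t within {0..})"
proof (induction k arbitrary: j)
  case 0
  show ?case
  proof (cases "t = 0")
    case True
    \<comment> \<open>The difference quotient at 0 is the flat function with index
      \<open>Suc j\<close>, whose limit is 0; so is the value of \<open>flat_deriv (Suc 0) j\<close>
      at 0.\<close>
    have "\<forall>\<^sub>F y in at_right 0. flat_deriv 0 (Suc j) y = (flat_deriv 0 j y - flat_deriv 0 j 0) / (y - 0)"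
      using eventually_at_right_less[of "0::real"] by eventually_elim simp
    then have "((\<lambda>y. (flat_deriv 0 j y - flat_deriv 0 j 0) / (y - 0)) \<longlongrightarrow> 0) (at_right 0)"
      using flat_tendsto_0[of "Suc j"] by (rule Lim_transform_eventually[rotated])
    then show ?thesis
      by (simp add: True has_field_derivative_iff at_within_Ici_at_right)
  next
    case False
    with assms have t: "0 < t" by simp
    \<comment> \<open>Differentiating \<open>t ^ j\<close> produces the truncated exponent
      \<open>j - 1\<close>, hence the case split on \<open>j\<close>.\<close>
    have "((\<lambda>t. exp (- (1 / t)) / t ^ j) has_real_derivative flat_deriv (Suc 0) j t) (at t)"
      using t by (auto intro!: derivative_eq_intros simp: field_simps)
        (cases j; simp add: field_simps power2_eq_square)
    then have "(flat_deriv 0 j has_real_derivative flat_deriv (Suc 0) j t) (at t)"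
      by (rule has_field_derivative_transform_within_open[where S = "{0<..}"]) (use t in auto)
    then show ?thesis by (rule has_field_derivative_at_within)
  qed
next
  case (Suc k)
  show ?case
    using DERIV_diff[OF Suc[of "j + 2"] DERIV_cmult[OF Suc[of "Suc j"], of "real j"]]
    by simp
qed

text \<open>For \<open>k = 0\<close> put \<open>u = 1 / t\<close> and use
  \<open>u ^ j \<le> exp u * fact j\<close>. Each derivative raises the index by at most 2, and the
  coefficients \<open>1 + j\<close> are paid for by one more factor of the factorial: 3 per
  derivative.\<close>

lemma flat_deriv_bound: "0 \<le> t \<Longrightarrow> \<bar>flat_deriv k j t\<bar> \<le> fact (j + 3 * k)"
proof (induction k arbitrary: j)
  case 0
  then show ?case
    using power_le_exp_fact[of "1 / t" j] by (auto simp: exp_minus field_simps)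
next
  case (Suc k)
  have "\<bar>flat_deriv (Suc k) j t\<bar> \<le> \<bar>flat_deriv k (j + 2) t\<bar> + real j * \<bar>flat_deriv k (Suc j) t\<bar>"
    using abs_triangle_ineq4[of "flat_deriv k (j + 2) t" "real j * flat_deriv k (Suc j) t"]
    by (simp add: abs_mult)
  also have "\<dots> \<le> fact (j + 2 + 3 * k) + real j * fact (Suc j + 3 * k)"
    using Suc.IH[OF Suc.prems] by (intro add_mono mult_left_mono) (simp_all only: of_nat_0_le_iff)
  also have "\<dots> \<le> fact (j + 2 + 3 * k) + real j * fact (j + 2 + 3 * k)"
    by (intro add_left_mono mult_left_mono fact_mono) auto
  also have "\<dots> = real (Suc j) * fact (j + 2 + 3 * k)"
    by (simp add: algebra_simps)
  also have "\<dots> \<le> real (Suc (j + 2 + 3 * k)) * fact (j + 2 + 3 * k)"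
    by (intro mult_right_mono) auto
  also have "\<dots> = fact (Suc (j + 2 + 3 * k))"
    by (simp only: fact_Suc)
  also have "Suc (j + 2 + 3 * k) = j + 3 * Suc k" by simp
  finally show ?case .
qed

text \<open>The quotient is a binomial coefficient, at most \<open>2 ^ (a + b)\<close>.\<close>

lemma fact_add_le: "(fact (a + b) :: real) \<le> 2 ^ (a + b) * (fact a * fact b)"
proof -
  have "(fact (a + b) :: real) = fact a * fact b * real ((a + b) choose a)"
    using binomial_fact_lemma[of a "a + b"]
    by (metis diff_add_inverse le_add1 of_nat_fact of_nat_mult)
  also have "\<dots> \<le> fact a * fact b * real (2 ^ (a + b))"
    using binomial_le_pow2[of "a + b" a] by (intro mult_left_mono) (simp_all only: of_nat_le_iff, auto)
  finally show ?thesis by (simp add: mult.commute)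
qed

text \<open>Splitting the factorial three times yields \<open>fact k ^ 3\<close> and powers of 2
  with exponents \<open>j + 3 * k\<close>, \<open>3 * k\<close> and \<open>2 * k\<close>, that is
  \<open>2 ^ j * 256 ^ k\<close>. Absorbing \<open>256 ^ k\<close> gives the fourth
  factorial.\<close>

lemma fact_add_3_mult_le: "(fact (j + 3 * k) :: real) \<le> (2 ^ j * fact j * exp 256) * fact k ^ 4"
proof -
  have "(fact (j + 3 * k) :: real) \<le> 2 ^ (j + 3 * k) * (fact j * fact (k + 2 * k))"
    using fact_add_le[of j "3 * k"] by simp
  also have "\<dots> \<le> 2 ^ (j + 3 * k) * (fact j * (2 ^ (k + 2 * k) * (fact k * fact (k + k))))"
    using fact_add_le[of k "2 * k"] by (intro mult_left_mono) (auto simp: mult_2)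
  also have "\<dots> \<le> 2 ^ (j + 3 * k) * (fact j * (2 ^ (k + 2 * k) * (fact k * (2 ^ (k + k) * (fact k * fact k)))))"
    using fact_add_le[of k k] by (intro mult_left_mono) auto
  also have "\<dots> = 2 ^ j * fact j * ((2 ^ 8) ^ k) * fact k ^ 3"
    by (simp add: power_mult[symmetric] power_add[symmetric] power3_eq_cube mult_ac del: power_numeral)
  also have "\<dots> \<le> 2 ^ j * fact j * (exp 256 * fact k) * fact k ^ 3"
    using power_le_exp_fact[of 256 k] by (intro mult_left_mono mult_right_mono) auto
  also have "\<dots> = (2 ^ j * fact j * exp 256) * fact k ^ 4"
    by (simp add: eval_nat_numeral mult_ac)
  finally show ?thesis .
qed

lemma continuous_on_coordinate: "continuous_on S (\<lambda>x::nat \<Rightarrow> real. x i)"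
  by (rule continuous_on_subset[OF continuous_on_product_coordinates subset_UNIV])

text \<open>The function depends on coordinate 0 alone, so a derivative involving any other
  coordinate vanishes and the one-variable bound carries over.\<close>

lemma gevrey_flat:
  assumes "1 \<le> n" "0 < \<epsilon>"
  shows "(\<lambda>x. flat_deriv 0 j (x 0)) \<in> gevrey_on_cube n \<epsilon>"
proof -
  have nonneg: "0 \<le> x 0" if "x \<in> cube n \<epsilon>" for x
    using cube_coord[OF that, of 0] assms by auto
  interpret iterated_partials n \<epsilon> "\<lambda>x. flat_deriv 0 j (x 0)"
    "\<lambda>L x. if set L \<subseteq> {0} then flat_deriv (length L) j (x 0) else 0"
  proof
    show "0 < \<epsilon>" by fact
    show "continuous_on (cube n \<epsilon>) (\<lambda>x. if set L \<subseteq> {0} then flat_deriv (length L) j (x 0) else 0)" for L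
    proof (cases "set L \<subseteq> {0}")
      case True
      have "continuous_on {0..} (flat_deriv (length L) j)"
        by (rule DERIV_continuous_on) (rule flat_deriv_DERIV, simp)
      then have "continuous_on (cube n \<epsilon>) (\<lambda>x. flat_deriv (length L) j (x 0))"
        by (rule continuous_on_compose2[OF _ continuous_on_coordinate]) (use nonneg in auto)
      then show ?thesis using True by simp
    qed simp
    fix L i x assume x: "i < n" "x \<in> cube n \<epsilon>"
    show "((\<lambda>t. if set L \<subseteq> {0} then flat_deriv (length L) j ((x(i := t)) 0) else 0) has_real_derivative
        (if set (i # L) \<subseteq> {0} then flat_deriv (length (i # L)) j (x 0) else 0)) (at (x i) within {0..\<epsilon>})"
    proof (cases "set L \<subseteq> {0} \<and> i = 0")
      case True
      have "(flat_deriv (length L) j has_real_derivative flat_deriv (Suc (length L)) j (x 0))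
          (at (x 0) within {0..\<epsilon>})"
        by (rule DERIV_subset[OF flat_deriv_DERIV[OF nonneg[OF x(2)]]]) auto
      then show ?thesis using True by simp
    next
      case False
      then show ?thesis by (cases "i = 0"; cases "set L \<subseteq> {0}") simp_all
    qed
  qed simp
  show ?thesis
  proof (rule gevreyI)
    fix L :: "nat list" and x assume "x \<in> cube n \<epsilon>"
    have "\<bar>flat_deriv (length L) j (x 0)\<bar> \<le> (2 ^ j * fact j * exp 256) * fact (length L) ^ 4"
      by (rule order_trans[OF flat_deriv_bound[OF nonneg] fact_add_3_mult_le]) fact
    then show "\<bar>if set L \<subseteq> {0} then flat_deriv (length L) j (x 0) else 0\<bar>
        \<le> (2 ^ j * fact j * exp 256) * fact (length L) ^ 4"
      by (auto split: if_splits)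
  qed simp
qed

lemma gevrey_coordinate:
  assumes "1 \<le> n" "0 < \<epsilon>"
  shows "(\<lambda>x. x 0) \<in> gevrey_on_cube n \<epsilon>"
proof -
  interpret iterated_partials n \<epsilon> "\<lambda>x. x 0"
    "\<lambda>L x. if L = [] then x 0 else if L = [0] then 1 else 0"
  proof
    show "0 < \<epsilon>" by fact
    show "continuous_on (cube n \<epsilon>) (\<lambda>x. if L = [] then x 0 else if L = [0] then 1 else 0)" for L
      by (cases "L = []") (auto intro: continuous_on_coordinate)
    show "((\<lambda>t. if L = [] then (x(i := t)) 0 else if L = [0] then 1 else 0) has_real_derivative
        (if i # L = [] then x 0 else if i # L = [0] then 1 else 0)) (at (x i) within {0..\<epsilon>})" for L i x
      by (cases "L = []"; cases "i = 0") auto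
  qed simp
  show ?thesis
  proof (rule gevreyI[of "\<epsilon> + 1" 0])
    fix L :: "nat list" and x assume "x \<in> cube n \<epsilon>"
    then show "\<bar>if L = [] then x 0 else if L = [0] then 1 else 0\<bar> \<le> (\<epsilon> + 1) * fact (length L) ^ 0"
      using cube_coord[of x n \<epsilon> 0] assms by auto
  qed (use assms in simp)
qed

text \<open>Near the origin the relation would make \<open>h\<close> the reciprocal of the
  coordinate at points where the flat function is nonzero, but \<open>h\<close> is bounded on its
  cube.\<close>

lemma flat_germ_not_dvd:
  assumes "1 \<le> n" "h \<in> carrier (representatives n)"
  shows "(\<lambda>x. flat_deriv 0 (Suc j) (x 0)) \<notin>
    null_germ n +>\<^bsub>representatives n\<^esub> (\<lambda>x. h x * flat_deriv 0 j (x 0))"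
proof
  assume "(\<lambda>x. flat_deriv 0 (Suc j) (x 0)) \<in>
    null_germ n +>\<^bsub>representatives n\<^esub> (\<lambda>x. h x * flat_deriv 0 j (x 0))"
  \<comment> \<open>Membership in the coset is an equation between total functions; the freedom of
    germs sits in \<open>z\<close>, which vanishes only on a small cube.\<close>
  then obtain z where z: "z \<in> null_germ n"
    and eq: "(\<lambda>x. flat_deriv 0 (Suc j) (x 0)) = (\<lambda>x. z x + h x * flat_deriv 0 j (x 0))"
    by (auto simp: a_r_coset_def r_coset_def representatives_simps)
  from z obtain \<delta> where \<delta>: "\<delta> > 0" "\<And>x. x \<in> cube n \<delta> \<Longrightarrow> z x = 0"
    by (auto simp: null_germ_def)
  obtain \<epsilon> where \<epsilon>: "\<epsilon> > 0" "h \<in> gevrey_on_cube n \<epsilon>"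
    using assms(2) by (auto simp: carrier_representatives)
  then have "h \<in> smooth_on_cube n \<epsilon>" by (simp add: gevrey_on_cube_def)
  from smooth_partial_bounded[OF this, of "[]"]
  obtain B where B: "B \<ge> 0" "\<And>x. x \<in> cube n \<epsilon> \<Longrightarrow> \<bar>h x\<bar> \<le> B"
    by (auto simp: partials_def)
  \<comment> \<open>The diagonal point with coordinates \<open>s\<close> lies in both cubes, and
    \<open>s \<le> 1 / (B + 1)\<close> forces \<open>h x * s \<le> B / (B + 1) < 1\<close>.\<close>
  define s where "s = min (min \<delta> \<epsilon>) (1 / (B + 1))"
  define x where "x = (\<lambda>i. if i < n then s else undefined)"
  have s: "0 < s" "s \<le> \<delta>" "s \<le> \<epsilon>" "s \<le> 1 / (B + 1)"
    using \<delta> \<epsilon> B by (auto simp: s_def)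
  have "x \<in> cube n s" unfolding cube_def
    by (rule PiE_I) (use s in \<open>simp_all add: x_def\<close>)
  then have x: "x \<in> cube n \<delta>" "x \<in> cube n \<epsilon>" using cube_mono s by blast+
  have "x 0 = s" using assms(1) by (simp add: x_def)
  then have "flat_deriv 0 (Suc j) s = h x * (s * flat_deriv 0 (Suc j) s)"
    using fun_cong[OF eq, of x] \<delta>(2)[OF x(1)] by (simp only: flat_deriv_0_eq_mult[of j s] add_0)
  moreover have "flat_deriv 0 (Suc j) s \<noteq> 0" using s by simp
  ultimately have "h x * s = 1" by simp
  moreover have "h x * s \<le> B * (1 / (B + 1))"
    using B(2)[OF x(2)] s B(1) by (intro mult_mono) auto
  ultimately show False using B(1) by (simp add: field_simps)
qed

lemma not_noetherian_germ_ring: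
  assumes "1 \<le> n"
  shows "\<not> noetherian_ring (germ_ring n)"
proof
  assume noeth: "noetherian_ring (germ_ring n)"
  let ?R = "representatives n" and ?I = "null_germ n"
  interpret ideal ?I ?R by (rule ideal_null_germ)
  define f where "f = (\<lambda>j (x :: nat \<Rightarrow> real). flat_deriv 0 j (x 0))"
  define X where "X = (\<lambda>x :: nat \<Rightarrow> real. x 0)"
  have f: "f j \<in> carrier ?R" for j
    unfolding f_def carrier_representatives using gevrey_flat[OF assms] zero_less_one by blast
  have X: "X \<in> carrier ?R"
    unfolding X_def carrier_representatives using gevrey_coordinate[OF assms] zero_less_one by blast
  have coset: "?I +>\<^bsub>?R\<^esub> g \<in> carrier (germ_ring n)" if "g \<in> carrier ?R" for g
    using a_rcosetsI[OF a_subset that] by (simp add: germ_ring_def FactRing_def)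
  have mult: "(?I +>\<^bsub>?R\<^esub> g) \<otimes>\<^bsub>germ_ring n\<^esub> (?I +>\<^bsub>?R\<^esub> h) = ?I +>\<^bsub>?R\<^esub> (\<lambda>x. g x * h x)"
    if "g \<in> carrier ?R" "h \<in> carrier ?R" for g h
    using rcoset_mult_add[OF that] by (simp add: germ_ring_def FactRing_def representatives_simps)
  have "\<exists>H\<in>carrier (germ_ring n). ?I +>\<^bsub>?R\<^esub> f j = H \<otimes>\<^bsub>germ_ring n\<^esub> (?I +>\<^bsub>?R\<^esub> f (Suc j))" for j
  proof (rule bexI[OF _ coset[OF X]])
    have "f j = (\<lambda>x. X x * f (Suc j) x)"
      unfolding f_def X_def by (rule ext) (rule flat_deriv_0_eq_mult)
    then show "?I +>\<^bsub>?R\<^esub> f j = (?I +>\<^bsub>?R\<^esub> X) \<otimes>\<^bsub>germ_ring n\<^esub> (?I +>\<^bsub>?R\<^esub> f (Suc j))"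
      using mult[OF X f] by simp
  qed
  then obtain j H where H: "H \<in> carrier (germ_ring n)"
    "?I +>\<^bsub>?R\<^esub> f (Suc j) = H \<otimes>\<^bsub>germ_ring n\<^esub> (?I +>\<^bsub>?R\<^esub> f j)"
    using noetherian_divisor_chain[OF cring_germ_ring noeth, of "\<lambda>j. ?I +>\<^bsub>?R\<^esub> f j"] coset[OF f]
    by blast
  then obtain h where h: "h \<in> carrier ?R" "H = ?I +>\<^bsub>?R\<^esub> h"
    by (auto simp: germ_ring_def FactRing_def A_RCOSETS_def')
  \<comment> \<open>Equality of cosets is turned into membership of a representative, since each
    function lies in its own coset.\<close>
  have "f (Suc j) \<in> ?I +>\<^bsub>?R\<^esub> (\<lambda>x. h x * f j x)"
    using a_rcos_self[OF f, of "Suc j"] H(2) mult[OF h(1) f] h(2) by simp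
  then show False
    using flat_germ_not_dvd[OF assms h(1)] by (simp add: f_def)
qed

theorem corollary6p7:
  shows "\<not> noetherian_system germ_ring \<and>
    (\<exists>m>1. cring (germ_ring m) \<and> \<not> noetherian_ring (germ_ring m))"
proof (intro conjI exI)
  show "\<not> noetherian_system germ_ring"
    unfolding noetherian_system_def using not_noetherian_germ_ring by blast
  \<comment> \<open>The witness is \<open>m = 2\<close>; the argument works in every positive
    dimension.\<close>
  show "(1::nat) < 2" by simp
qed (simp_all add: cring_germ_ring not_noetherian_germ_ring)

end
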